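(* Let $\mathcal C_X$ be the two-qubit CNOT channel, with Alice holding the target qubit and Bob the control qubit. Then $C(\mathcal C_X^{\otimes n})=2$ for all $n\ge1$.
   Context: All systems are finite-dimensional quantum systems; system $X$ has complex Hilbert space $\mathcal H_X$ of dimension $d_X$, and the composite system $XY$ has Hilbert space $\mathcal H_X\otimes\mathcal H_Y$. $\mathsf{St}(X)$ is the set of density operators on $\mathcal H_X$. $\mathfrak C(X)$ is the set of quantum channels (completely positive trace-preserving linear maps) on operators on $\mathcal H_X$. $\mathcal I_X$ is the identity channel on $X$. $\|X\|_1=\mathrm{Tr}\sqrt{X^\dagger X}$. For a Hermitian-preserving linear map $\mathcal L$ with input system $X$, the diamond norm is $\|\mathcal L\|_\diamond=\sup_{\rho\in\mathsf{St}(EX)}\|(\mathcal I_E\otimes\mathcal L)(\rho)\|_1$ with $E\cong X$. For a bipartite unitary channel $\mathcal U:\rho\mapsto U\rho U^\dagger$ with $U:\mathcal H_A\otimes\mathcal H_B\to\mathcal H_{A'}\otimes\mathcal H_{B'}$ unitary, let $\mathcal T(\mathcal U)=(\mathcal I_A\otimes\mathcal U)\circ(\mathcal S_{AA}\otimes\mathcal I_B)\circ(\mathcal I_A\otimes\mathcal U^{-1})\in\mathfrak C(AA'B')$, where $\mathcal S_{AA}$ is the swap of two copies of $A$. The causal influence of $\mathcal U$ (from $A$ to $B'$) is $$C(\mathcal U)=\inf_{\mathcal C\in\mathfrak C(AA')}\|\mathcal T(\mathcal U)-\mathcal C\otimes\mathcal I_{B'}\|_\diamond .$$ The CNOT gate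 is the unitary on $\mathbb C^2\otimes\mathbb C^2$ with $\mathrm{CNOT}(|a\rangle\otimes|b\rangle)=|a\oplus b\rangle\otimes|b\rangle$ for $a,b\in\{0,1\}$ ($\oplus$ is addition modulo 2), and $\mathcal C_X:\rho\mapsto\mathrm{CNOT}\,\rho\,\mathrm{CNOT}$. Alice's input $A$ and output $A'$ are the first (target) qubit and Bob's input $B$ and output $B'$ are the second (control) qubit. $\mathcal C_X^{\otimes n}$ is regarded as a bipartite unitary channel with Alice's input $A^{\otimes n}$ and output $A'^{\otimes n}$, and Bob's input $B^{\otimes n}$ and output $B'^{\otimes n}$ ($n$ qubits each). *)

theory Defs
  imports "HOL-Analysis.Analysis"
begin

text \<open>
  A quantum system is given by a finite type \<open>'x\<close> that labels its computational basis: its Hilbert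
  space is \<open>complex ^ 'x\<close>, and the composite of \<open>'x\<close> and \<open>'y\<close> is \<open>'x \<times> 'y\<close>, the pair \<open>(i, j)\<close>
  labelling the product vector of \<open>i\<close> and \<open>j\<close>.
\<close>

type_synonym 'x oper = "complex ^ 'x ^ 'x"

definition adjoint_mat :: "complex ^ 'n ^ 'm \<Rightarrow> complex ^ 'm ^ 'n" where
  "adjoint_mat M = (\<chi> i j. cnj (M $ j $ i))"

definition hinner :: "complex ^ 'x \<Rightarrow> complex ^ 'x \<Rightarrow> complex" where
  "hinner v w = (\<Sum>i\<in>UNIV. cnj (v $ i) * w $ i)"

definition psd :: "('x::finite) oper \<Rightarrow> bool" where
  "psd M \<longleftrightarrow> (\<forall>v. hinner v (M *v v) \<in> \<real>\<^sub>\<ge>\<^sub>0)"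

definition density :: "('x::finite) oper set" where
  "density = {\<rho>. psd \<rho> \<and> trace \<rho> = 1}"

definition psd_sqrt :: "('x::finite) oper \<Rightarrow> 'x oper" where
  "psd_sqrt M = (THE S. psd S \<and> S ** S = M)"

definition trace_norm :: "('x::finite) oper \<Rightarrow> real" where
  "trace_norm M = Re (trace (psd_sqrt (adjoint_mat M ** M)))"

definition op_scale :: "complex \<Rightarrow> ('x::finite) oper \<Rightarrow> 'x oper" where
  "op_scale c M = (\<chi> i j. c * M $ i $ j)"

definition op_linear :: "(('x::finite) oper \<Rightarrow> ('y::finite) oper) \<Rightarrow> bool" where
  "op_linear L \<longleftrightarrow> Vector_Spaces.linear op_scale op_scale L"

text \<open>
  An operator on the composite of a \<open>k\<close>-dimensional ancilla and \<open>'x\<close> is a \<open>k \<times> k\<close> array of blocks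
  \<open>M i j\<close>. The identity on the ancilla tensored with \<open>L\<close> acts by applying \<open>L\<close> to every block, so
  complete positivity can quantify over all ancilla dimensions \<open>k\<close>.
\<close>

definition block_psd :: "nat \<Rightarrow> (nat \<Rightarrow> nat \<Rightarrow> ('x::finite) oper) \<Rightarrow> bool" where
  "block_psd k M \<longleftrightarrow>
     (\<forall>v :: nat \<Rightarrow> complex ^ 'x. (\<Sum>i<k. \<Sum>j<k. hinner (v i) (M i j *v v j)) \<in> \<real>\<^sub>\<ge>\<^sub>0)"

definition completely_positive :: "(('x::finite) oper \<Rightarrow> ('y::finite) oper) \<Rightarrow> bool" where
  "completely_positive L \<longleftrightarrow> (\<forall>k M. block_psd k M \<longrightarrow> block_psd k (\<lambda>i j. L (M i j)))"

definition trace_preserving :: "(('x::finite) oper \<Rightarrow> ('y::finite) oper) \<Rightarrow> bool" where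
  "trace_preserving L \<longleftrightarrow> (\<forall>M. trace (L M) = trace M)"

definition channels :: "(('x::finite) oper \<Rightarrow> ('y::finite) oper) set" where
  "channels = {L. op_linear L \<and> completely_positive L \<and> trace_preserving L}"

definition mat_unit :: "('x::finite) \<Rightarrow> 'x \<Rightarrow> 'x oper" where
  "mat_unit i j = (\<chi> k l. if k = i \<and> l = j then 1 else 0)"

text \<open>
  Tensor products of linear maps on operators, by expansion of the argument in matrix units:
  the unit indexed by \<open>(p, q)\<close> is the tensor product of the units of the components, and is sent to
  the tensor product of their images. In \<open>tensor_power\<close> the tensor factors are labelled by the
  elements of the finite type \<open>'n\<close>, so this is the power with exponent \<open>CARD('n)\<close>, and the basis of
  the power system is labelled by \<open>'n \<Rightarrow> 'x\<close>.
\<close>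

definition tensor_map ::
  "(('x::finite) oper \<Rightarrow> ('y::finite) oper) \<Rightarrow> (('z::finite) oper \<Rightarrow> ('w::finite) oper)
     \<Rightarrow> ('x \<times> 'z) oper \<Rightarrow> ('y \<times> 'w) oper" where
  "tensor_map L K M = (\<chi> u v. \<Sum>p\<in>UNIV. \<Sum>q\<in>UNIV. M $ p $ q *
     (L (mat_unit (fst p) (fst q)) $ fst u $ fst v * K (mat_unit (snd p) (snd q)) $ snd u $ snd v))"

definition tensor_power ::
  "(('x::finite) oper \<Rightarrow> ('y::finite) oper) \<Rightarrow> (('n::finite) \<Rightarrow> 'x) oper \<Rightarrow> ('n \<Rightarrow> 'y) oper" where
  "tensor_power L M = (\<chi> u v. \<Sum>p\<in>UNIV. \<Sum>q\<in>UNIV. M $ p $ q *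
     (\<Prod>i\<in>UNIV. L (mat_unit (p i) (q i)) $ u i $ v i))"

definition diamond_norm :: "(('x::finite) oper \<Rightarrow> ('y::finite) oper) \<Rightarrow> real" where
  "diamond_norm L =
     (SUP \<rho>\<in>(density :: ('x \<times> 'x) oper set). trace_norm (tensor_map (id :: 'x oper \<Rightarrow> 'x oper) L \<rho>))"

text \<open>
  For a bijection \<open>f\<close>, \<open>relabel f\<close> is conjugation by the unitary permuting the basis along the
  inverse of \<open>f\<close>. It provides the swap and the canonical identifications of composite systems.
\<close>

definition relabel :: "(('y::finite) \<Rightarrow> ('x::finite)) \<Rightarrow> 'x oper \<Rightarrow> 'y oper" where
  "relabel f M = (\<chi> i j. M $ f i $ f j)"

definition swap_channel :: "(('a::finite) \<times> 'a) oper \<Rightarrow> ('a \<times> 'a) oper" where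
  "swap_channel = relabel prod.swap"

definition assoc_left :: "(('a::finite) \<times> (('b::finite) \<times> ('c::finite))) oper \<Rightarrow> (('a \<times> 'b) \<times> 'c) oper" where
  "assoc_left = relabel (\<lambda>((a, b), c). (a, (b, c)))"

definition assoc_right :: "((('a::finite) \<times> ('b::finite)) \<times> ('c::finite)) oper \<Rightarrow> ('a \<times> ('b \<times> 'c)) oper" where
  "assoc_right = relabel (\<lambda>(a, (b, c)). ((a, b), c))"

text \<open>
  Alice has input \<open>'a\<close> and output \<open>'a1\<close>, Bob has input \<open>'b\<close> and output \<open>'b1\<close>. The inverse
  channel is the inverse function, which for a unitary channel is conjugation by the adjoint.
\<close>

definition T_channel ::
  "((('a::finite) \<times> ('b::finite)) oper \<Rightarrow> (('a1::finite) \<times> ('b1::finite)) oper)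
     \<Rightarrow> (('a \<times> 'a1) \<times> 'b1) oper \<Rightarrow> (('a \<times> 'a1) \<times> 'b1) oper" where
  "T_channel \<U> =
     assoc_left \<circ> tensor_map (id :: 'a oper \<Rightarrow> 'a oper) \<U> \<circ> assoc_right
     \<circ> tensor_map (swap_channel :: ('a \<times> 'a) oper \<Rightarrow> ('a \<times> 'a) oper) (id :: 'b oper \<Rightarrow> 'b oper)
     \<circ> assoc_left \<circ> tensor_map (id :: 'a oper \<Rightarrow> 'a oper) (inv \<U>) \<circ> assoc_right"

definition causal_influence ::
  "((('a::finite) \<times> ('b::finite)) oper \<Rightarrow> (('a1::finite) \<times> ('b1::finite)) oper) \<Rightarrow> real" where
  "causal_influence \<U> =
     (INF C\<in>(channels :: (('a \<times> 'a1) oper \<Rightarrow> ('a \<times> 'a1) oper) set).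
        diamond_norm (\<lambda>\<rho>. T_channel \<U> \<rho> - tensor_map C (id :: 'b1 oper \<Rightarrow> 'b1 oper) \<rho>))"

text \<open>
  The tensor power of a bipartite map, with the copies of the first (Alice's) systems and those of
  the second (Bob's) systems grouped together.
\<close>

definition bipartite_power ::
  "((('a::finite) \<times> ('b::finite)) oper \<Rightarrow> (('a1::finite) \<times> ('b1::finite)) oper)
     \<Rightarrow> ((('n::finite) \<Rightarrow> 'a) \<times> ('n \<Rightarrow> 'b)) oper \<Rightarrow> (('n \<Rightarrow> 'a1) \<times> ('n \<Rightarrow> 'b1)) oper" where
  "bipartite_power \<U> =
     relabel (\<lambda>(f, g) i. (f i, g i)) \<circ> tensor_power \<U> \<circ> relabel (\<lambda>h. (fst \<circ> h, snd \<circ> h))"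

text \<open>
  The qubit has basis labels in the two-element type \<open>2\<close>, whose addition is addition modulo 2.
  The first qubit is the target, the second the control.
\<close>

definition CNOT :: "(2 \<times> 2) oper" where
  "CNOT = (\<chi> i j. if i = (fst j + snd j, snd j) then 1 else 0)"

definition cnot_channel :: "(2 \<times> 2) oper \<Rightarrow> (2 \<times> 2) oper" where
  "cnot_channel \<rho> = CNOT ** \<rho> ** CNOT"

end

theory Submission
  imports Defs
begin

text \<open>
  For the \<open>n\<close>-fold CNOT gate the channel \<open>T\<close> permutes the basis along \<open>(x, a, b) \<mapsto> (a + b, x + b, b)\<close>:
  Bob's register controls a simultaneous shift of Alice's two registers. If these are prepared in an
  eigenvector of all the shifts on which they act by a nontrivial character, and Bob's register in the uniform
  superposition, then \<open>T\<close> turns Bob's state into the character, which is orthogonal to the uniform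
  superposition, whereas a channel acting only on Alice's side leaves Bob's state unchanged. The two outputs
  are therefore perfectly distinguishable, whatever the channel on Alice's side, and the diamond
  norm attains its maximal value \<open>2\<close>.
\<close>

subsection \<open>Spectral decomposition and the trace norm\<close>

text \<open>A maximiser of the quadratic form on the unit sphere of \<open>S\<close> is an eigenvector.\<close>

lemma self_adjoint_eigenvector:
  fixes f :: "'a::euclidean_space \<Rightarrow> 'a"
  assumes lin: "linear f" and sa: "\<And>x y. f x \<bullet> y = x \<bullet> f y"
    and S: "subspace S" and inv: "\<And>x. x \<in> S \<Longrightarrow> f x \<in> S" and w: "w \<in> S" "w \<noteq> 0"
  obtains v m where "v \<in> S" "norm v = 1" "f v = m *\<^sub>R v"
proof -
  have norm1: "x /\<^sub>R norm x \<in> S \<inter> sphere 0 1" if "x \<in> S" "x \<noteq> 0" for x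
    using that S by (simp add: subspace_scale)
  have "compact (S \<inter> sphere 0 1)"
    using S by (simp add: closed_Int_compact closed_subspace)
  moreover have "S \<inter> sphere 0 1 \<noteq> {}" using norm1[OF w] by blast
  moreover have "continuous_on (S \<inter> sphere 0 1) (\<lambda>x. x \<bullet> f x)"
    by (intro continuous_intros linear_continuous_on linear_conv_bounded_linear[THEN iffD1] lin)
  ultimately obtain v where v: "v \<in> S" "norm v = 1"
    and max: "\<And>x. x \<in> S \<inter> sphere 0 1 \<Longrightarrow> x \<bullet> f x \<le> v \<bullet> f v"
    using continuous_attains_sup[of "S \<inter> sphere 0 1" "\<lambda>x. x \<bullet> f x"] by (metis IntE dist_0_norm mem_sphere)
  define m where "m = v \<bullet> f v"
  \<comment> \<open>Both sides scale quadratically, so the maximum on the sphere bounds the form on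
    all of \<open>S\<close>.\<close>
  have bound: "x \<bullet> f x \<le> m * (x \<bullet> x)" if "x \<in> S" for x
  proof (cases "x = 0")
    case False
    then have "(x /\<^sub>R norm x) \<bullet> f (x /\<^sub>R norm x) \<le> m"
      using max[OF norm1] that by (simp add: m_def)
    then show ?thesis
      using False by (simp add: linear_cmul[OF lin] field_simps norm_eq_sqrt_inner)
  qed (simp add: linear_0[OF lin])
  define u where "u = m *\<^sub>R v - f v"
  define c where "c = m * (u \<bullet> u) - u \<bullet> f u"
  have uS: "u \<in> S" unfolding u_def by (intro subspace_diff subspace_scale S inv v)
  \<comment> \<open>The bound is applied to \<open>v\<close> perturbed along the residual
    \<open>u\<close>. The constant term in \<open>t\<close> vanishes because \<open>v\<close>
    attains the maximum, and the linear coefficient is twice the squared length of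
    \<open>u\<close>.\<close>
  have quad: "0 \<le> 2 * t * (u \<bullet> u) + t^2 * c" for t
  proof -
    have "v + t *\<^sub>R u \<in> S" by (intro subspace_add subspace_scale S v uS)
    from bound[OF this] have "0 \<le> m * ((v + t *\<^sub>R u) \<bullet> (v + t *\<^sub>R u)) - (v + t *\<^sub>R u) \<bullet> f (v + t *\<^sub>R u)"
      by simp
    also have "\<dots> = m * (v \<bullet> v) - v \<bullet> f v + t * (2 * m * (u \<bullet> v) - u \<bullet> f v - v \<bullet> f u) + t^2 * c"
      by (simp add: linear_add[OF lin] linear_cmul[OF lin] inner_add c_def algebra_simps
          power2_eq_square inner_commute)
    also have "v \<bullet> f u = u \<bullet> f v" by (metis sa inner_commute)
    also have "m * (v \<bullet> v) - v \<bullet> f v = 0" using v by (simp add: m_def norm_eq_1)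
    also have "2 * m * (u \<bullet> v) - u \<bullet> f v - u \<bullet> f v = 2 * (u \<bullet> u)"
      by (subst (4) u_def) (simp add: inner_diff algebra_simps)
    finally show ?thesis by (simp add: algebra_simps)
  qed
  have "u \<bullet> u = 0"
  proof (rule ccontr)
    assume "u \<bullet> u \<noteq> 0"
    then have a: "u \<bullet> u > 0" by simp
    \<comment> \<open>A negative \<open>t\<close> so short that the quadratic term takes back at
      most half of the linear one, which makes the polynomial negative.\<close>
    define t where "t = - (u \<bullet> u) / (\<bar>c\<bar> + 1)"
    have t: "t < 0" using a by (simp add: t_def)
    have "0 \<le> t * (2 * (u \<bullet> u) + t * c)"
      using quad[of t] by (simp add: power2_eq_square algebra_simps)
    then have "2 * (u \<bullet> u) + t * c \<le> 0" using t by (simp add: zero_le_mult_iff)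
    moreover have "t * c \<ge> - (u \<bullet> u)"
    proof -
      have "(u \<bullet> u) * c \<le> (u \<bullet> u) * (\<bar>c\<bar> + 1)" using a by (intro mult_left_mono) auto
      then show ?thesis by (simp add: t_def field_simps)
    qed
    ultimately show False using a by simp
  qed
  then have "f v = m *\<^sub>R v" by (simp add: u_def)
  with v show ?thesis using that by blast
qed

text \<open>Bridge to the underlying real Euclidean space, where the eigenvector lemma and the bound
  on independent sets apply.\<close>

lemma Re_hinner: "Re (hinner v w) = v \<bullet> w"
  by (simp add: hinner_def inner_vec_def inner_complex_def)

lemma hinner_self: "hinner v v = complex_of_real ((norm v)\<^sup>2)"
proof (rule complex_eqI)
  show "Im (hinner v v) = Im (complex_of_real ((norm v)\<^sup>2))"
    by (simp add: hinner_def)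
qed (simp add: Re_hinner power2_norm_eq_inner)

lemma hinner_self_eq_0 [simp]: "hinner v v = 0 \<longleftrightarrow> v = 0"
  by (simp add: hinner_self)

lemma hinner_commute: "hinner w v = cnj (hinner v w)"
  by (simp add: hinner_def mult.commute)

section \<open>Algebra of the Hermitian form and the adjoint\<close>

lemma hinner_0 [simp]: "hinner v 0 = 0" "hinner 0 v = 0"
  by (simp_all add: hinner_def)

lemma hinner_add: "hinner u (v + w) = hinner u v + hinner u w" "hinner (u + v) w = hinner u w + hinner v w"
  by (simp_all add: hinner_def algebra_simps sum.distrib)

lemma hinner_diff: "hinner u (v - w) = hinner u v - hinner u w" "hinner (u - v) w = hinner u w - hinner v w"
  by (simp_all add: hinner_def algebra_simps sum_subtractf)

lemma hinner_scale: "hinner u (c *s v) = c * hinner u v" "hinner (c *s u) v = cnj c * hinner u v"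
  by (simp_all add: hinner_def vector_scalar_mult_def sum_distrib_left algebra_simps)

lemma hinner_sum: "hinner u (\<Sum>x\<in>X. f x) = (\<Sum>x\<in>X. hinner u (f x))" 
  by (induction X rule: infinite_finite_induct) (simp_all add: hinner_add)

lemma hinner_adjoint: "hinner (adjoint_mat M *v u) v = hinner u (M *v v)"
  by (simp add: hinner_def adjoint_mat_def matrix_vector_mult_def sum_distrib_left sum_distrib_right
        algebra_simps) (rule sum.swap)

lemma adjoint_mat_simps:
  "adjoint_mat (A + B) = adjoint_mat A + adjoint_mat B"
  "adjoint_mat (A - B) = adjoint_mat A - adjoint_mat B"
  "adjoint_mat (A ** B) = adjoint_mat B ** adjoint_mat A"
  "adjoint_mat 0 = 0"
  by (simp_all add: adjoint_mat_def vec_eq_iff matrix_matrix_mult_def mult.commute)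

lemma matrix_vector_mult_sum:
  fixes A :: "'a::comm_semiring_1 ^ 'n ^ 'm"
  shows "A *v (\<Sum>x\<in>X. f x) = (\<Sum>x\<in>X. A *v f x)"
  by (induction X rule: infinite_finite_induct) (simp_all add: matrix_vector_right_distrib)

section \<open>Positive semidefinite operators and eigenbases\<close>

lemma psdI: "(\<And>v. hinner v (M *v v) \<in> \<real>\<^sub>\<ge>\<^sub>0) \<Longrightarrow> psd M"
  by (simp add: psd_def)

lemma psd_Re: "psd M \<Longrightarrow> 0 \<le> Re (hinner v (M *v v))"
  by (auto simp: psd_def complex_nonneg_Reals_iff)

text \<open>Polarisation: the form is real at \<open>x + y\<close> and at \<open>x + \<i> y\<close>,
  which gives the imaginary and the real part of conjugate symmetry.\<close>

lemma psd_adjoint: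
  assumes "psd M" shows "adjoint_mat M = M"
proof -
  let ?b = "\<lambda>x y. hinner x (M *v y)"
  have im: "Im (?b v v) = 0" for v
    using assms by (auto simp: psd_def complex_nonneg_Reals_iff)
  have exp: "?b (x + c *s y) (x + c *s y) = ?b x x + c * ?b x y + cnj c * ?b y x + cnj c * c * ?b y y" for x y c
    by (simp add: matrix_vector_right_distrib vector_scalar_commute hinner_add hinner_scale algebra_simps)
  have "?b y x = cnj (?b x y)" for x y
  proof (rule complex_eqI)
    show "Im (?b y x) = Im (cnj (?b x y))"
      using arg_cong[OF exp[of x 1 y], of Im] im by simp
    show "Re (?b y x) = Re (cnj (?b x y))"
      using arg_cong[OF exp[of x \<i> y], of Im] im by simp
  qed
  moreover have "?b (axis i 1) (axis j 1) = M $ i $ j" for i j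
    by (simp add: hinner_def axis_def matrix_vector_mult_def if_distrib if_distribR cong: if_cong)
  ultimately show ?thesis unfolding adjoint_mat_def vec_eq_iff by (metis vec_lambda_beta complex_cnj_cnj)
qed

text \<open>Complex orthonormality implies real orthogonality, hence real independence. The bound is
  thus the real dimension, twice the complex one; it serves to choose a set of maximal size.\<close>

lemma orthonormal_finite:
  fixes E :: "(complex ^ 'n::finite) set"
  assumes "\<And>v w. v \<in> E \<Longrightarrow> w \<in> E \<Longrightarrow> hinner v w = (if v = w then 1 else 0)"
  shows "finite E" "card E \<le> DIM(complex ^ 'n)"
proof -
  have "pairwise orthogonal E"
    unfolding pairwise_def orthogonal_def using assms by (metis Re_hinner zero_complex.sel(1))
  moreover have "0 \<notin> E" using assms[of 0 0] by auto
  ultimately have "independent E" by (rule pairwise_orthogonal_independent)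
  then show "finite E" "card E \<le> DIM(complex ^ 'n)"
    using independent_bound by blast+
qed

text \<open>Eigenvalues are attached to the vectors themselves, so multiplicities need no indexing.
  Completeness takes the form of the expansion of every vector.\<close>

definition eigenbasis :: "('n::finite) oper \<Rightarrow> (complex ^ 'n) set \<Rightarrow> (complex ^ 'n \<Rightarrow> real) \<Rightarrow> bool" where
  "eigenbasis M E l \<longleftrightarrow> finite E \<and>
     (\<forall>v\<in>E. \<forall>w\<in>E. hinner v w = (if v = w then 1 else 0)) \<and>
     (\<forall>v\<in>E. M *v v = complex_of_real (l v) *s v) \<and>
     (\<forall>w. (\<Sum>v\<in>E. hinner v w *s v) = w)"

lemma eigenbasisD:
  assumes "eigenbasis M E l"
  shows "finite E"
    and "v \<in> E \<Longrightarrow> w \<in> E \<Longrightarrow> hinner v w = (if v = w then 1 else 0)"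
    and "v \<in> E \<Longrightarrow> M *v v = complex_of_real (l v) *s v"
    and "(\<Sum>v\<in>E. hinner v w *s v) = w"
  using assms unfolding eigenbasis_def by blast+

lemma hermitian_spectral:
  fixes M :: "('n::finite) oper"
  assumes herm: "adjoint_mat M = M"
  obtains E l where "eigenbasis M E l"
proof -
  \<comment> \<open>Take a maximal orthonormal set of eigenvectors: its orthogonal complement is invariant and
    contains no eigenvector, hence is trivial.\<close>
  define good where "good E \<longleftrightarrow>
     (\<forall>v\<in>E. \<forall>w\<in>E. hinner v w = (if v = w then 1 else 0)) \<and>
     (\<forall>v\<in>E. \<exists>m. M *v v = complex_of_real m *s v)" for E
  have fin: "finite E" "card E \<le> DIM(complex ^ 'n)" if "good E" for E
    using orthonormal_finite[of E] that unfolding good_def by blast+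
  have "good {}" by (simp add: good_def)
  then obtain E where E: "good E" and max: "\<And>F. good F \<Longrightarrow> card F \<le> card E"
    using Lattices_Big.ex_has_greatest_nat[of good "{}" card "Suc (DIM(complex ^ 'n))"] fin(2)
    unfolding less_Suc_eq_le by blast
  obtain l where l: "\<And>v. v \<in> E \<Longrightarrow> M *v v = complex_of_real (l v) *s v"
    using E unfolding good_def by metis
  have on: "hinner v w = (if v = w then 1 else 0)" if "v \<in> E" "w \<in> E" for v w
    using E that unfolding good_def by blast
  define W where "W = {w. \<forall>e\<in>E. hinner e w = 0}"
  \<comment> \<open>The eigenvector lemma is about real spaces, so \<open>W\<close> and
    multiplication by \<open>M\<close> are treated as real subspace and real linear map.\<close>
  have scaleR: "c *\<^sub>R v = complex_of_real c *s v" for c and v :: "complex ^ 'n"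
    by (simp add: vec_eq_iff scaleR_conv_of_real[where 'a = complex])
  have sub: "subspace W"
    unfolding subspace_def W_def by (simp add: hinner_add scaleR hinner_scale)
  have inv: "M *v w \<in> W" if "w \<in> W" for w
  proof -
    have "hinner e (M *v w) = 0" if "e \<in> E" for e
      using \<open>w \<in> W\<close> that l[OF that] hinner_adjoint[of M e w] by (simp add: herm hinner_scale W_def)
    then show ?thesis by (simp add: W_def)
  qed
  have lin: "linear ((*v) M)"
    by (rule linearI) (simp_all add: matrix_vector_right_distrib scaleR vector_scalar_commute)
  have sa: "(M *v x) \<bullet> y = x \<bullet> (M *v y)" for x y
    by (metis Re_hinner hinner_adjoint herm)
  have nW: "v \<notin> W" if v: "norm v = 1" "M *v v = m *\<^sub>R v" for v m
  proof
    assume W: "v \<in> W"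
    have "v \<notin> E"
      using W v on[of v v] unfolding W_def by auto
    moreover have "good (insert v E)"
      using E v W unfolding good_def W_def
      by (auto simp: hinner_self scaleR hinner_commute[of v] split: if_splits)
    ultimately show False using max[of "insert v E"] fin(1)[OF E] by simp
  qed
  have W0: "w = 0" if "w \<in> W" for w
  proof (rule ccontr)
    assume "w \<noteq> 0"
    from self_adjoint_eigenvector[OF lin sa sub inv that this] show False using nW by blast
  qed
  have "(\<Sum>v\<in>E. hinner v w *s v) = w" for w
  proof -
    have "hinner e (w - (\<Sum>v\<in>E. hinner v w *s v)) = 0" if "e \<in> E" for e
    proof -
      have "hinner e (\<Sum>v\<in>E. hinner v w *s v) = (\<Sum>v\<in>E. if e = v then hinner v w else 0)"
        unfolding hinner_sum by (rule sum.cong) (auto simp: hinner_scale on that)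
      then show ?thesis using that fin(1)[OF E] by (simp add: hinner_diff)
    qed
    then have "w - (\<Sum>v\<in>E. hinner v w *s v) \<in> W" by (simp add: W_def)
    then show ?thesis using W0 by fastforce
  qed
  then have "eigenbasis M E l" using fin(1)[OF E] on l by (simp add: eigenbasis_def)
  then show ?thesis by (rule that)
qed

text \<open>On an eigenvector \<open>v\<close> of \<open>S\<close> with eigenvalue
  \<open>l v\<close>, the equation of squares factors as \<open>(R + l v)(R - l v) v = 0\<close>.
  Then \<open>d = (R - l v) v\<close> satisfies \<open>R d = - l v d\<close>, and positivity of
  \<open>R\<close> forces \<open>d = 0\<close>.\<close>

lemma psd_sqrt_unique:
  fixes R S :: "('n::finite) oper"
  assumes "psd R" "psd S" "R ** R = S ** S"
  shows "R = S"
proof -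
  obtain E l where eb: "eigenbasis S E l"
    using hermitian_spectral[OF psd_adjoint[OF assms(2)]] .
  note on = eigenbasisD(2)[OF eb] and l = eigenbasisD(3)[OF eb] and span = eigenbasisD(4)[OF eb]
  have eq: "R *v v = S *v v" if v: "v \<in> E" for v
  proof -
    have l0: "l v \<ge> 0" using psd_Re[OF assms(2), of v] by (simp add: l v hinner_scale on)
    define d where "d = R *v v - complex_of_real (l v) *s v"
    have "R *v (R *v v) = complex_of_real (l v) *s (complex_of_real (l v) *s v)"
      using assms(3) l[OF v] by (metis matrix_vector_mul_assoc vector_scalar_commute)
    then have Rd: "R *v d = - (complex_of_real (l v) *s d)"
      by (simp add: d_def matrix_vector_mult_diff_distrib vector_scalar_commute vector_ssub_ldistrib)
    have "d = 0"
    \<comment> \<open>At eigenvalue zero the sign gives no contradiction; instead \<open>R\<close>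
      is self-adjoint, so \<open>R (R v) = 0\<close> makes the norm of \<open>R v\<close>
      vanish.\<close>
    proof (cases "l v = 0")
      case True
      then have "R *v (R *v v) = 0" using Rd d_def by simp
      then have "hinner (R *v v) (R *v v) = 0"
        using hinner_adjoint[of R v "R *v v"] psd_adjoint[OF assms(1)] by simp
      then show ?thesis using True by (simp add: d_def)
    next
      case False
      have "R *v d = complex_of_real (- l v) *s d"
        by (simp add: Rd vector_smult_lneg)
      then have "l v * (norm d)\<^sup>2 \<le> 0"
        using psd_Re[OF assms(1), of d] by (simp add: hinner_self hinner_scale del: of_real_minus of_real_power)
      then show ?thesis using False l0 by (simp add: mult_le_0_iff)
    qed
    then show ?thesis by (simp add: d_def l v)
  qed
  have "R *v w = S *v w" for w
  proof -
    have "R *v (\<Sum>v\<in>E. hinner v w *s v) = S *v (\<Sum>v\<in>E. hinner v w *s v)"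
      using eq by (simp add: matrix_vector_mult_sum vector_scalar_commute)
    then show ?thesis by (simp add: span)
  qed
  then show ?thesis by (simp add: matrix_eq)
qed

lemma psd_sqrt_eqI: "psd S \<Longrightarrow> S ** S = M \<Longrightarrow> psd_sqrt M = S"
  unfolding psd_sqrt_def by (rule the_equality) (auto intro: psd_sqrt_unique)

section \<open>Rank-one operators and trace norms of differences\<close>

lemma psd_add: "psd P \<Longrightarrow> psd Q \<Longrightarrow> psd (P + Q)"
  by (auto simp: psd_def matrix_vector_mult_add_rdistrib hinner_add intro: nonneg_Reals_add_I)

definition outer :: "complex ^ 'n \<Rightarrow> ('n::finite) oper" where
  "outer v = (\<chi> i j. v $ i * cnj (v $ j))"

lemma outer_mult: "outer v *v w = hinner v w *s v"
  by (simp add: vec_eq_iff outer_def matrix_vector_mult_def hinner_def sum_distrib_left sum_distrib_right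
      algebra_simps)

lemma trace_outer: "trace (A ** outer v) = hinner v (A *v v)"
  by (simp add: trace_def outer_def hinner_def matrix_vector_mult_def matrix_matrix_mult_def
      sum_distrib_left algebra_simps)

lemma psd_outer: "psd (outer v)"
proof (rule psdI)
  fix w
  have "hinner w (outer v *v w) = complex_of_real ((cmod (hinner v w))\<^sup>2)"
    by (simp add: outer_mult hinner_scale hinner_commute[of w v] complex_norm_square del: of_real_power)
  then show "hinner w (outer v *v w) \<in> \<real>\<^sub>\<ge>\<^sub>0" by simp
qed

text \<open>In an eigenbasis of \<open>P - Q\<close> the trace norm is the sum of the
  \<open>\<bar>l v\<bar>\<close>, and each \<open>l v\<close> is a difference of the nonnegative
  diagonal entries of \<open>P\<close> and \<open>Q\<close>.\<close>

lemma trace_norm_diff_le: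
  fixes P Q :: "('n::finite) oper"
  assumes "psd P" "psd Q"
  shows "trace_norm (P - Q) \<le> Re (trace P) + Re (trace Q)"
proof -
  have adj: "adjoint_mat (P - Q) = P - Q"
    by (simp add: adjoint_mat_simps psd_adjoint assms)
  obtain E l where eb: "eigenbasis (P - Q) E l"
    using hermitian_spectral[OF adj] .
  note fin = eigenbasisD(1)[OF eb] and on = eigenbasisD(2)[OF eb] and l = eigenbasisD(3)[OF eb]
    and span = eigenbasisD(4)[OF eb]
  \<comment> \<open>The absolute value of \<open>P - Q\<close>: same eigenvectors, eigenvalues
    replaced by their moduli.\<close>
  define S where "S = matrix (\<lambda>w. \<Sum>v\<in>E. (complex_of_real \<bar>l v\<bar> * hinner v w) *s v)"
  have S: "S *v w = (\<Sum>v\<in>E. (complex_of_real \<bar>l v\<bar> * hinner v w) *s v)" for w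
  proof -
    have "Vector_Spaces.linear (*s) (*s) (\<lambda>w. \<Sum>v\<in>E. (complex_of_real \<bar>l v\<bar> * hinner v w) *s v)"
      by unfold_locales
         (simp_all add: hinner_add hinner_scale sum.distrib vec.scale_sum_right vector_sadd_rdistrib
          algebra_simps)
    then show ?thesis unfolding S_def by (rule matrix_works)
  qed
  have Sv: "S *v v = complex_of_real \<bar>l v\<bar> *s v" if "v \<in> E" for v
  proof -
    have "S *v v = (\<Sum>u\<in>E. if u = v then complex_of_real \<bar>l v\<bar> *s v else 0)"
      unfolding S by (rule sum.cong) (auto simp: on that)
    then show ?thesis using fin that by simp
  qed
  \<comment> \<open>The resolution of the identity into the projections \<open>outer v\<close> lets
    the trace be taken in the eigenbasis.\<close>
  have tr: "trace A = (\<Sum>v\<in>E. hinner v (A *v v))" for A :: "'n oper"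
  proof -
    have "A = (\<Sum>v\<in>E. A ** outer v)"
      unfolding matrix_eq
    proof
      fix w
      have sv: "(\<Sum>v\<in>E. A ** outer v) *v w = (\<Sum>v\<in>E. (A ** outer v) *v w)"
        by (induction E rule: infinite_finite_induct) (simp_all add: matrix_vector_mult_add_rdistrib)
      have "A *v w = A *v (\<Sum>v\<in>E. hinner v w *s v)" by (simp add: span)
      then show "A *v w = (\<Sum>v\<in>E. A ** outer v) *v w"
        by (simp add: sv matrix_vector_mult_sum outer_mult flip: matrix_vector_mul_assoc)
    qed
    then have "trace A = trace (\<Sum>v\<in>E. A ** outer v)" by simp
    also have "\<dots> = (\<Sum>v\<in>E. trace (A ** outer v))"
      by (induction E rule: infinite_finite_induct) (simp_all add: trace_add trace_0[unfolded mat_0])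
    finally show ?thesis by (simp add: trace_outer)
  qed
  have psdS: "psd S"
  proof (rule psdI)
    fix w
    have "hinner w (S *v w) = (\<Sum>v\<in>E. complex_of_real (\<bar>l v\<bar> * (cmod (hinner v w))\<^sup>2))"
      unfolding S hinner_sum
      by (rule sum.cong) (simp_all add: hinner_scale hinner_commute[of w] complex_norm_square mult.assoc mult.commute del: of_real_power)
    then have "hinner w (S *v w) = complex_of_real (\<Sum>v\<in>E. \<bar>l v\<bar> * (cmod (hinner v w))\<^sup>2)"
      by simp
    then show "hinner w (S *v w) \<in> \<real>\<^sub>\<ge>\<^sub>0"
      by (simp only: nonneg_Reals_of_real_iff) (simp add: sum_nonneg)
  qed
  have "S ** S = adjoint_mat (P - Q) ** (P - Q)"
    unfolding matrix_eq adj
  proof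
    fix w
    have on_E: "(S ** S) *v v = ((P - Q) ** (P - Q)) *v v" if "v \<in> E" for v
    proof -
      have "complex_of_real \<bar>l v\<bar> * complex_of_real \<bar>l v\<bar> = complex_of_real (l v) * complex_of_real (l v)"
        by (metis abs_mult_self_eq of_real_mult)
      then show ?thesis using that
        by (simp add: Sv l vector_scalar_commute vector_smult_assoc flip: matrix_vector_mul_assoc)
    qed
    have "(S ** S) *v (\<Sum>v\<in>E. hinner v w *s v) = ((P - Q) ** (P - Q)) *v (\<Sum>v\<in>E. hinner v w *s v)"
      using on_E by (simp add: matrix_vector_mult_sum vector_scalar_commute)
    then show "(S ** S) *v w = ((P - Q) ** (P - Q)) *v w" by (simp add: span)
  qed
  from psd_sqrt_eqI[OF psdS this] have "trace_norm (P - Q) = Re (trace S)"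
    by (simp add: trace_norm_def)
  also have "\<dots> = (\<Sum>v\<in>E. \<bar>l v\<bar>)"
    unfolding tr by (simp add: Sv hinner_scale on)
  also have "\<dots> \<le> (\<Sum>v\<in>E. Re (hinner v (P *v v)) + Re (hinner v (Q *v v)))"
  proof (rule sum_mono)
    fix v assume v: "v \<in> E"
    have "hinner v (P *v v) - hinner v (Q *v v) = hinner v ((P - Q) *v v)"
      by (simp add: matrix_vector_mult_diff_rdistrib hinner_diff)
    also have "\<dots> = complex_of_real (l v)" by (simp only: l[OF v] hinner_scale on[OF v v]) simp
    finally have "l v = Re (hinner v (P *v v)) - Re (hinner v (Q *v v))"
      by (simp add: complex_eq_iff)
    moreover have "Re (hinner v (P *v v)) \<ge> 0" "Re (hinner v (Q *v v)) \<ge> 0"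
      using assms psd_Re by blast+
    ultimately show "\<bar>l v\<bar> \<le> Re (hinner v (P *v v)) + Re (hinner v (Q *v v))" by simp
  qed
  finally show ?thesis by (simp add: tr sum.distrib)
qed

text \<open>Both products of \<open>P\<close> and \<open>Q\<close> vanish, so \<open>P + Q\<close>
  and \<open>P - Q\<close> have the same square and \<open>P + Q\<close> is the absolute value of
  \<open>P - Q\<close>.\<close>

lemma trace_norm_diff_orthogonal:
  fixes P Q :: "('n::finite) oper"
  assumes "psd P" "psd Q" "P ** Q = 0"
  shows "trace_norm (P - Q) = Re (trace P) + Re (trace Q)"
proof -
  have adj: "adjoint_mat P = P" "adjoint_mat Q = Q" using assms psd_adjoint by blast+
  then have "Q ** P = 0" using adjoint_mat_simps(3)[of P Q] assms(3) by (simp add: adjoint_mat_simps)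
  then have "(P + Q) ** (P + Q) = adjoint_mat (P - Q) ** (P - Q)"
    using assms(3) unfolding matrix_eq by (simp add: adjoint_mat_simps adj algebra_simps flip: matrix_vector_mul_assoc)
  from psd_sqrt_eqI[OF psd_add[OF assms(1,2)] this] show ?thesis
    by (simp add: trace_norm_def trace_add)
qed

subsection \<open>The CNOT channel as a permutation of the basis\<close>

lemma sum_UNIV_prod: "(\<Sum>p\<in>UNIV. f p) = (\<Sum>a\<in>UNIV. \<Sum>b\<in>UNIV. f (a :: 'a::finite, b :: 'b::finite))"
  by (simp add: sum.cartesian_product flip: UNIV_Times_UNIV)

lemma sum_delta2:
  fixes F :: "'a::finite \<Rightarrow> 'b::finite \<Rightarrow> 'c::comm_monoid_add"
  shows "(\<Sum>p\<in>UNIV. \<Sum>q\<in>UNIV. if p = a \<and> q = b then F p q else 0) = F a b"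
proof -
  have "(\<Sum>p\<in>UNIV. \<Sum>q\<in>UNIV. if p = a \<and> q = b then F p q else 0)
      = (\<Sum>p\<in>UNIV. if p = a then \<Sum>q\<in>UNIV. if q = b then F p q else 0 else 0)"
    by (intro sum.cong) auto
  then show ?thesis by simp
qed

lemma relabel_nth [simp]: "relabel f M $ i $ j = M $ f i $ f j"
  by (simp add: relabel_def)

lemma mat_unit_nth: "mat_unit i j $ k $ l = (if k = i \<and> l = j then 1 else 0)"
  by (simp add: mat_unit_def)

lemma relabel_comp: "relabel f \<circ> relabel g = relabel (g \<circ> f)"
  by (simp add: fun_eq_iff relabel_def)

lemma relabel_id: "relabel (\<lambda>x. x) = id" "relabel id = id"
  by (simp_all add: fun_eq_iff relabel_def)

text \<open>Together with \<open>relabel_comp\<close> this reduces a circuit of basis permutations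
  to a composition of label maps.\<close>

lemma tensor_map_relabel: "tensor_map (relabel f) (relabel g) = relabel (map_prod f g)"
proof (rule ext)
  fix M
  have "M $ p $ q * (relabel f (mat_unit (fst p) (fst q)) $ fst u $ fst v
          * relabel g (mat_unit (snd p) (snd q)) $ snd u $ snd v)
      = (if p = map_prod f g u \<and> q = map_prod f g v then M $ p $ q else 0)" for u v p q
    by (auto simp: mat_unit_nth prod_eq_iff)
  then show "tensor_map (relabel f) (relabel g) M = relabel (map_prod f g) M"
    by (simp add: tensor_map_def vec_eq_iff sum_delta2)
qed

lemma tensor_power_relabel:
  "tensor_power (relabel f) = (relabel (\<lambda>u i. f (u i)) :: (('n::finite) \<Rightarrow> _) oper \<Rightarrow> _)"
proof (rule ext)
  fix M :: "('n \<Rightarrow> _) oper"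
  have "(\<Prod>i\<in>UNIV. relabel f (mat_unit (p i) (q i)) $ u i $ v i)
      = (if p = (\<lambda>i. f (u i)) \<and> q = (\<lambda>i. f (v i)) then 1 else 0)" for u v and p q :: "'n \<Rightarrow> _"
  proof (cases "p = (\<lambda>i. f (u i)) \<and> q = (\<lambda>i. f (v i))")
    case False
    \<comment> \<open>One mismatched coordinate already annihilates the product.\<close>
    then obtain i where "p i \<noteq> f (u i) \<or> q i \<noteq> f (v i)" by (auto simp: fun_eq_iff)
    then have "relabel f (mat_unit (p i) (q i)) $ u i $ v i = 0" by (auto simp: mat_unit_nth)
    then have "(\<Prod>i\<in>UNIV. relabel f (mat_unit (p i) (q i)) $ u i $ v i) = 0" by (intro prod_zero) auto
    then show ?thesis by (simp only: if_not_P[OF False])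
  qed (simp add: mat_unit_nth)
  then have "M $ p $ q * (\<Prod>i\<in>UNIV. relabel f (mat_unit (p i) (q i)) $ u i $ v i)
      = (if p = (\<lambda>i. f (u i)) \<and> q = (\<lambda>i. f (v i)) then M $ p $ q else 0)" for u v p q
    by simp
  then show "tensor_power (relabel f) M = relabel (\<lambda>u i. f (u i)) M"
    unfolding tensor_power_def by (simp add: vec_eq_iff sum_delta2)
qed

section \<open>Arithmetic modulo 2 and the CNOT circuit\<close>

lemma two_add_self [simp]: "x + x = (0 :: 2)"
  using exhaust_2[of x] by auto

lemma two_add_cancel [simp]: "x + y + y = (x :: 2)"
  by (simp add: add.assoc)

lemma cnot_channel_eq: "cnot_channel = relabel (\<lambda>(a, b). (a + b, b))"
proof (rule ext)
  fix \<rho> :: "(2 \<times> 2) oper"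
  \<comment> \<open>The label map is an involution, so the matrix is symmetric: \<open>C\<close>
    determines the column from the row, \<open>C'\<close> the row from the column.\<close>
  have C: "CNOT $ i $ k = (if k = (fst i + snd i, snd i) then 1 else 0)" for i k
    by (auto simp: CNOT_def prod_eq_iff)
  have C': "CNOT $ k $ j = (if k = (fst j + snd j, snd j) then 1 else 0)" for j k
    by (auto simp: CNOT_def)
  have "cnot_channel \<rho> $ i $ j = \<rho> $ (fst i + snd i, snd i) $ (fst j + snd j, snd j)" for i j
  proof -
    have "cnot_channel \<rho> $ i $ j = (\<Sum>k\<in>UNIV. (\<Sum>l\<in>UNIV. CNOT $ i $ l * \<rho> $ l $ k) * CNOT $ k $ j)"
      by (simp add: cnot_channel_def matrix_matrix_mult_def)
    also have "\<dots> = (\<Sum>k\<in>UNIV. \<Sum>l\<in>UNIV.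
        if k = (fst j + snd j, snd j) \<and> l = (fst i + snd i, snd i) then \<rho> $ l $ k else 0)"
      unfolding sum_distrib_right by (intro sum.cong refl) (simp only: C C', simp)
    finally show ?thesis by (simp only: sum_delta2)
  qed
  then show "cnot_channel \<rho> = relabel (\<lambda>(a, b). (a + b, b)) \<rho>"
    by (simp add: vec_eq_iff)
qed

lemma bipartite_power_cnot:
  "(bipartite_power cnot_channel :: (('n::finite \<Rightarrow> 2) \<times> ('n \<Rightarrow> 2)) oper \<Rightarrow> _) =
     relabel (\<lambda>(f, g). (\<lambda>i. f i + g i, g))"
  unfolding bipartite_power_def cnot_channel_eq tensor_power_relabel relabel_comp
  by (rule arg_cong[where f = relabel]) (simp add: fun_eq_iff)

text \<open>The label map of \<open>T_channel\<close>. It is an involution, so the direction in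
  which \<open>relabel\<close> reads it makes no difference.\<close>

definition twist :: "(('n \<Rightarrow> 2) \<times> ('n \<Rightarrow> 2)) \<times> ('n \<Rightarrow> 2) \<Rightarrow> (('n \<Rightarrow> 2) \<times> ('n \<Rightarrow> 2)) \<times> ('n \<Rightarrow> 2)" where
  "twist = (\<lambda>((x, a), b). ((\<lambda>i. a i + b i, \<lambda>i. x i + b i), b))"

lemma bij_twist: "bij twist"
  by (rule o_bij[of twist]) (auto simp: twist_def fun_eq_iff)

text \<open>On labels, undoing the gate gives \<open>(x, a + b, b)\<close>, the swap gives
  \<open>(a + b, x, b)\<close>, and the gate gives \<open>(a + b, x + b, b)\<close>. The gate is its
  own inverse.\<close>

lemma T_channel_cnot:
  "T_channel (bipartite_power cnot_channel :: (('n::finite \<Rightarrow> 2) \<times> ('n \<Rightarrow> 2)) oper \<Rightarrow> _) =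
     relabel twist"
proof -
  let ?f = "\<lambda>(f, g). (\<lambda>i. f i + g i, g :: 'n \<Rightarrow> 2)"
  have "relabel ?f \<circ> relabel ?f = id"
    unfolding relabel_comp by (simp add: comp_def split_beta relabel_id)
  then have inv: "inv (relabel ?f) = relabel ?f"
    by (intro inv_unique_comp)
  show ?thesis
    unfolding T_channel_def assoc_left_def assoc_right_def swap_channel_def bipartite_power_cnot inv
      relabel_id(2)[symmetric] tensor_map_relabel relabel_comp
    by (rule arg_cong[where f = relabel]) (simp add: fun_eq_iff twist_def)
qed

subsection \<open>Channels acting on one tensor factor\<close>

lemma hinner_mat: "hinner v (M *v w) = (\<Sum>i\<in>UNIV. \<Sum>j\<in>UNIV. cnj (v $ i) * M $ i $ j * w $ j)"
  by (simp add: hinner_def matrix_vector_mult_def sum_distrib_left mult.assoc)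

lemma trace_relabel: "bij f \<Longrightarrow> trace (relabel f M) = trace M"
  unfolding trace_def by (simp add: sum.reindex_bij_betw[of f UNIV UNIV "\<lambda>i. M $ i $ i"])

lemma psd_relabel:
  fixes f :: "'y::finite \<Rightarrow> 'x::finite"
  assumes f: "bij f" and M: "psd M"
  shows "psd (relabel f M)"
proof (rule psdI)
  fix v :: "complex ^ 'y"
  define w :: "complex ^ 'x" where "w = (\<chi> k. v $ inv f k)"
  have w: "w $ f i = v $ i" for i
    using f by (simp add: w_def bij_is_inj inv_f_f)
  have "hinner w (M *v w) = (\<Sum>i\<in>UNIV. \<Sum>j\<in>UNIV. cnj (w $ f i) * M $ f i $ f j * w $ f j)"
    unfolding hinner_mat
    by (subst sum.reindex_bij_betw[OF f, symmetric], intro sum.cong refl,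
        subst sum.reindex_bij_betw[OF f, symmetric]) simp
  then have "hinner v (relabel f M *v v) = hinner w (M *v w)"
    by (simp add: hinner_mat w)
  with M show "hinner v (relabel f M *v v) \<in> \<real>\<^sub>\<ge>\<^sub>0" by (simp add: psd_def)
qed

lemma density_relabel: "bij f \<Longrightarrow> \<rho> \<in> density \<Longrightarrow> relabel f \<rho> \<in> density"
  by (simp add: density_def psd_relabel trace_relabel)

text \<open>\<open>tensor_map\<close> evaluates its factors on matrix units only; linearity recovers
  their values on all operators.\<close>

lemma op_linear_expand:
  assumes "op_linear L"
  shows "L M $ x $ y = (\<Sum>p\<in>UNIV. \<Sum>q\<in>UNIV. M $ p $ q * L (mat_unit p q) $ x $ y)"
proof -
  interpret Vector_Spaces.linear op_scale op_scale L using assms by (simp add: op_linear_def)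
  have "M = (\<Sum>p\<in>UNIV. \<Sum>q\<in>UNIV. op_scale (M $ p $ q) (mat_unit p q))"
  proof -
    have "(\<Sum>p\<in>UNIV. \<Sum>q\<in>UNIV. M $ p $ q * mat_unit p q $ i $ j) = M $ i $ j" for i j
    proof -
      have "(\<Sum>p\<in>UNIV. \<Sum>q\<in>UNIV. M $ p $ q * mat_unit p q $ i $ j)
          = (\<Sum>p\<in>UNIV. \<Sum>q\<in>UNIV. if p = i \<and> q = j then M $ p $ q else 0)"
        by (intro sum.cong refl) (auto simp: mat_unit_nth)
      then show ?thesis by (simp only: sum_delta2)
    qed
    then show ?thesis by (simp add: vec_eq_iff op_scale_def)
  qed
  then have "L M = (\<Sum>p\<in>UNIV. \<Sum>q\<in>UNIV. op_scale (M $ p $ q) (L (mat_unit p q)))"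
    by (metis (no_types, lifting) sum scale sum.cong)
  then show ?thesis by (simp add: op_scale_def)
qed

lemma vector_space_op_scale: "vector_space (op_scale :: complex \<Rightarrow> ('x::finite) oper \<Rightarrow> 'x oper)"
  by unfold_locales (simp_all add: op_scale_def vec_eq_iff algebra_simps)

lemma op_linearI:
  assumes "\<And>A B. L (A + B) = L A + L B" "\<And>c A. L (op_scale c A) = op_scale c (L A)"
  shows "op_linear L"
  unfolding op_linear_def Vector_Spaces.linear_def module_hom_def module_hom_axioms_def
  using assms by (simp add: module_iff_vector_space vector_space_op_scale)

lemma op_linear_tensor_map: "op_linear (tensor_map L K)"
  by (rule op_linearI)
     (simp_all add: tensor_map_def op_scale_def vec_eq_iff sum.distrib sum_distrib_left algebra_simps)

text \<open>The expansion in matrix units agrees with the blockwise action used to define complete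
  positivity.\<close>

lemma tensor_map_id_left:
  assumes "op_linear L"
  shows "tensor_map id L N $ (k, x) $ (l, y) = L (\<chi> r s. N $ (k, r) $ (l, s)) $ x $ y"
proof -
  have "tensor_map id L N $ (k, x) $ (l, y) =
     (\<Sum>a\<in>UNIV. \<Sum>r\<in>UNIV. \<Sum>b\<in>UNIV. \<Sum>s\<in>UNIV.
        if a = k \<and> b = l then N $ (a, r) $ (b, s) * L (mat_unit r s) $ x $ y else 0)"
    unfolding tensor_map_def by (simp add: sum_UNIV_prod) (intro sum.cong refl, auto simp: mat_unit_nth)
  also have "\<dots> = (\<Sum>r\<in>UNIV. \<Sum>s\<in>UNIV. \<Sum>a\<in>UNIV. \<Sum>b\<in>UNIV.
        if a = k \<and> b = l then N $ (a, r) $ (b, s) * L (mat_unit r s) $ x $ y else 0)"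
    by (subst sum.swap, rule sum.cong[OF refl], subst sum.swap[of _ UNIV UNIV], subst (2) sum.swap) (rule refl)
  also have "\<dots> = L (\<chi> r s. N $ (k, r) $ (l, s)) $ x $ y"
    by (simp add: sum_delta2 op_linear_expand[OF assms, of "\<chi> r s. N $ (k, r) $ (l, s)"])
  finally show ?thesis .
qed

lemma tensor_map_id_right:
  assumes "op_linear L"
  shows "tensor_map L id N $ (x, k) $ (y, l) = L (\<chi> r s. N $ (r, k) $ (s, l)) $ x $ y"
proof -
  have "tensor_map L id N $ (x, k) $ (y, l) =
     (\<Sum>r\<in>UNIV. \<Sum>a\<in>UNIV. \<Sum>s\<in>UNIV. \<Sum>b\<in>UNIV.
        if a = k \<and> b = l then N $ (r, a) $ (s, b) * L (mat_unit r s) $ x $ y else 0)"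
    unfolding tensor_map_def by (simp add: sum_UNIV_prod) (intro sum.cong refl, auto simp: mat_unit_nth)
  also have "\<dots> = (\<Sum>r\<in>UNIV. \<Sum>s\<in>UNIV. \<Sum>a\<in>UNIV. \<Sum>b\<in>UNIV.
        if a = k \<and> b = l then N $ (r, a) $ (s, b) * L (mat_unit r s) $ x $ y else 0)"
    by (intro sum.cong refl sum.swap)
  also have "\<dots> = L (\<chi> r s. N $ (r, k) $ (s, l)) $ x $ y"
    by (simp add: sum_delta2 op_linear_expand[OF assms, of "\<chi> r s. N $ (r, k) $ (s, l)"])
  finally show ?thesis .
qed

text \<open>Complete positivity numbers the ancilla basis by naturals, composite systems label it by
  a type; the enumeration \<open>h\<close> translates between the two quadratic forms.\<close>

lemma block_form:
  fixes N :: "('k::finite \<times> 'x::finite) oper"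
  assumes h: "bij_betw h {..<n::nat} UNIV"
  shows "(\<Sum>i<n. \<Sum>j<n. hinner (\<chi> x. w $ (h i, x)) ((\<chi> r s. N $ (h i, r) $ (h j, s)) *v (\<chi> x. w $ (h j, x))))
    = hinner w (N *v w)"
proof -
  let ?g = "\<lambda>k l. hinner (\<chi> x. w $ (k, x)) ((\<chi> r s. N $ (k, r) $ (l, s)) *v (\<chi> x. w $ (l, x)))"
  have "(\<Sum>i<n. \<Sum>j<n. ?g (h i) (h j)) = (\<Sum>k\<in>UNIV. \<Sum>l\<in>UNIV. ?g k l)"
    by (subst sum.reindex_bij_betw[OF h, symmetric, of "\<lambda>k. \<Sum>l\<in>UNIV. ?g k l"], intro sum.cong refl,
        rule sum.reindex_bij_betw[OF h])
  also have "\<dots> = hinner w (N *v w)"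
    unfolding hinner_mat sum_UNIV_prod by (simp, rule sum.cong[OF refl], rule sum.swap)
  finally show ?thesis .
qed

lemma psd_tensor_id:
  fixes L :: "('x::finite) oper \<Rightarrow> ('y::finite) oper" and N :: "('k::finite \<times> 'x) oper"
  assumes lin: "op_linear L" and cp: "completely_positive L" and N: "psd N"
  shows "psd (tensor_map id L N)"
proof (rule psdI)
  fix w :: "complex ^ ('k \<times> 'y)"
  obtain h :: "nat \<Rightarrow> 'k" where h: "bij_betw h {..<CARD('k)} UNIV"
    using ex_bij_betw_nat_finite[of "UNIV :: 'k set"] by (auto simp: atLeast0LessThan)
  have "block_psd CARD('k) (\<lambda>i j. \<chi> r s. N $ (h i, r) $ (h j, s))"
    unfolding block_psd_def
  proof
    fix v :: "nat \<Rightarrow> complex ^ 'x"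
    \<comment> \<open>The vectors \<open>v i\<close> are glued into one vector on the composite
      system, with \<open>v i\<close> in the block labelled \<open>h i\<close>.\<close>
    define u where "u = (\<chi> p. v (the_inv_into {..<CARD('k)} h (fst p)) $ snd p)"
    have u: "(\<chi> x. u $ (h i, x)) = v i" if "i < CARD('k)" for i
      using the_inv_into_f_f[OF bij_betw_imp_inj_on[OF h], of i] that by (simp add: u_def vec_eq_iff)
    have "(\<Sum>i<CARD('k). \<Sum>j<CARD('k). hinner (v i) ((\<chi> r s. N $ (h i, r) $ (h j, s)) *v v j))
        = hinner u (N *v u)"
      unfolding block_form[OF h, symmetric] by (intro sum.cong refl) (simp add: u)
    then show "(\<Sum>i<CARD('k). \<Sum>j<CARD('k). hinner (v i) ((\<chi> r s. N $ (h i, r) $ (h j, s)) *v v j)) \<in> \<real>\<^sub>\<ge>\<^sub>0"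
      using N by (simp add: psd_def)
  qed
  then have "block_psd CARD('k) (\<lambda>i j. L (\<chi> r s. N $ (h i, r) $ (h j, s)))"
    using cp unfolding completely_positive_def by blast
  moreover have "L (\<chi> r s. N $ (k, r) $ (l, s)) = (\<chi> r s. tensor_map id L N $ (k, r) $ (l, s))" for k l
    by (simp add: vec_eq_iff tensor_map_id_left[OF lin])
  ultimately have "block_psd CARD('k) (\<lambda>i j. (\<chi> r s. tensor_map id L N $ (h i, r) $ (h j, s)))"
    by simp
  then show "hinner w (tensor_map id L N *v w) \<in> \<real>\<^sub>\<ge>\<^sub>0"
    unfolding block_psd_def block_form[OF h, symmetric] by (rule spec)
qed

lemma trace_tensor_id:
  assumes "op_linear L" "trace_preserving L"
  shows "trace (tensor_map id L N) = trace N"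
proof -
  have "trace (tensor_map id L N) = (\<Sum>k\<in>UNIV. trace (L (\<chi> r s. N $ (k, r) $ (k, s))))"
    by (simp add: trace_def sum_UNIV_prod tensor_map_id_left[OF assms(1)])
  also have "\<dots> = (\<Sum>k\<in>UNIV. trace (\<chi> r s. N $ (k, r) $ (k, s)))"
    using assms(2) by (simp add: trace_preserving_def)
  also have "\<dots> = trace N" by (simp add: trace_def sum_UNIV_prod)
  finally show ?thesis .
qed

text \<open>The labels of the ancilla and of Bob merely select a block on which \<open>L\<close>
  acts.\<close>

lemma tensor_map_local:
  assumes "op_linear L"
  shows "tensor_map id (tensor_map L id) M $ (e, (x, b)) $ (e', (y, b'))
    = L (\<chi> r s. M $ (e, (r, b)) $ (e', (s, b'))) $ x $ y"
  by (simp add: tensor_map_id_left[OF op_linear_tensor_map] tensor_map_id_right[OF assms])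

lemma density_local:
  fixes L :: "('x::finite) oper \<Rightarrow> ('y::finite) oper" and \<rho> :: "('e::finite \<times> ('x \<times> 'b::finite)) oper"
  assumes L: "L \<in> channels" and \<rho>: "\<rho> \<in> density"
  shows "tensor_map id (tensor_map L id) \<rho> \<in> density"
proof -
  have lin: "op_linear L" and cp: "completely_positive L" and tp: "trace_preserving L"
    using L by (auto simp: channels_def)
  \<comment> \<open>Bob's register is regrouped with the ancilla into one larger ancilla, so that
    complete positivity of \<open>L\<close> applies directly.\<close>
  let ?f = "\<lambda>((e, b), x). (e, (x, b))" and ?g = "\<lambda>(e, (x, b)). ((e, b), x)"
  have bf: "bij (?f :: ('e \<times> 'b) \<times> 'x \<Rightarrow> _)" by (rule o_bij[of ?g]) auto
  have bg: "bij (?g :: 'e \<times> ('y \<times> 'b) \<Rightarrow> _)" by (rule o_bij[of ?f]) auto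
  have "tensor_map id (tensor_map L id) \<rho> = relabel ?g (tensor_map id L (relabel ?f \<rho>))"
    by (simp add: vec_eq_iff split_paired_all tensor_map_local[OF lin] tensor_map_id_left[OF lin])
  moreover have "tensor_map id L (relabel ?f \<rho>) \<in> density"
  proof -
    have "relabel ?f \<rho> \<in> density" by (rule density_relabel[OF bf \<rho>])
    then show ?thesis
      unfolding density_def by (simp add: psd_tensor_id[OF lin cp] trace_tensor_id[OF lin tp])
  qed
  ultimately show ?thesis using density_relabel[OF bg] by simp
qed

subsection \<open>The distinguishing state\<close>

text \<open>Shows that the infimum over channels ranges over a nonempty set.\<close>

lemma id_channel: "id \<in> channels"
  unfolding channels_def
  by (auto intro!: op_linearI simp: completely_positive_def trace_preserving_def)

section \<open>Distances between density operators\<close>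

lemma trace_norm_density_diff_le:
  "P \<in> density \<Longrightarrow> Q \<in> density \<Longrightarrow> trace_norm (P - Q) \<le> 2"
  using trace_norm_diff_le[of P Q] by (simp add: density_def)

lemma trace_norm_density_diff_orthogonal:
  "P \<in> density \<Longrightarrow> Q \<in> density \<Longrightarrow> P ** Q = 0 \<Longrightarrow> trace_norm (P - Q) = 2"
  using trace_norm_diff_orthogonal[of P Q] by (simp add: density_def)

lemma density_outer:
  assumes "(\<Sum>i\<in>UNIV. (cmod (v $ i))\<^sup>2) = 1"
  shows "outer v \<in> density"
proof -
  have "trace (outer v) = complex_of_real (\<Sum>i\<in>UNIV. (cmod (v $ i))\<^sup>2)"
    by (simp add: trace_def outer_def flip: complex_norm_square del: of_real_power)
  then show ?thesis using assms by (simp add: density_def psd_outer)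
qed

lemma tensor_map_diff_right:
  "tensor_map id (\<lambda>M. L M - K M) \<rho> = tensor_map id L \<rho> - tensor_map id K \<rho>"
  by (simp add: tensor_map_def vec_eq_iff right_diff_distrib sum_subtractf)

text \<open>A nontrivial character of the group of bit strings under addition modulo 2, given by the
  sign of bit \<open>i\<close>.\<close>

definition parity :: "'n \<Rightarrow> ('n \<Rightarrow> 2) \<Rightarrow> complex" where
  "parity i b = (if b i = 0 then 1 else -1)"

lemma parity_simps [simp]:
  "cnj (parity i b) = parity i b" "cmod (parity i b) = 1"
  by (simp_all add: parity_def)

lemma parity_add: "parity i (\<lambda>j. a j + b j) = parity i a * parity i b"
  using exhaust_2[of "a i"] exhaust_2[of "b i"] by (auto simp: parity_def)

text \<open>Flipping bit \<open>i\<close> permutes the strings and negates every term, so the sum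
  equals its own negative.\<close>

lemma sum_parity: "(\<Sum>b\<in>UNIV. parity (i :: 'n::finite) b) = 0"
proof -
  let ?f = "\<lambda>b j. b j + (if j = i then 1 else 0 :: 2)"
  have "bij ?f" by (rule o_bij[of ?f]) (simp_all add: fun_eq_iff)
  then have "(\<Sum>b\<in>UNIV. parity i (?f b)) = (\<Sum>b\<in>UNIV. parity i b)"
    by (rule sum.reindex_bij_betw)
  moreover have "parity i (?f b) = - parity i b" for b
    unfolding parity_add by (simp add: parity_def)
  ultimately show ?thesis by (simp add: sum_negf)
qed

text \<open>
  Bob's register is in the uniform superposition, and Alice's two registers are in the superposition
  of the \<open>|x, x\<rangle>\<close> with signs \<open>parity i x\<close>, an eigenvector of the simultaneous shift by \<open>b\<close> with
  eigenvalue \<open>parity i b\<close>. The ancilla is idle.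
\<close>

definition probe :: "'n::finite \<Rightarrow> complex ^ ('e::finite \<times> (('n \<Rightarrow> 2) \<times> ('n \<Rightarrow> 2)) \<times> ('n \<Rightarrow> 2))" where
  "probe i = (\<chi> p. case p of (e, (x, a), b) \<Rightarrow>
     if e = undefined \<and> x = a then parity i x / of_nat CARD('n \<Rightarrow> 2) else 0)"

text \<open>The ancilla sits at one arbitrary fixed label. With \<open>x = a\<close>, there are
  \<open>N\<close> choices of \<open>x\<close> and \<open>N\<close> of \<open>b\<close>, and each of
  these entries has squared modulus \<open>1 / N^2\<close>.\<close>

lemma probe_density:
  "outer (probe (i :: 'n::finite) :: complex ^ ('e::finite \<times> (('n \<Rightarrow> 2) \<times> ('n \<Rightarrow> 2)) \<times> ('n \<Rightarrow> 2))) \<in> density"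
proof (rule density_outer)
  let ?N = "CARD('n \<Rightarrow> 2)" and ?\<phi> = "probe i :: complex ^ ('e \<times> (('n \<Rightarrow> 2) \<times> ('n \<Rightarrow> 2)) \<times> ('n \<Rightarrow> 2))"
  have entry: "(cmod (?\<phi> $ (e, (x, a), b)))\<^sup>2 = (if e = undefined \<and> x = a then 1 / (real ?N)\<^sup>2 else 0)" for e x a b
    by (simp add: probe_def norm_divide power_divide)
  have "(\<Sum>p\<in>UNIV. (cmod (?\<phi> $ p))\<^sup>2)
      = (\<Sum>e\<in>(UNIV :: 'e set). \<Sum>x\<in>(UNIV :: ('n \<Rightarrow> 2) set). \<Sum>a\<in>UNIV. \<Sum>b\<in>(UNIV :: ('n \<Rightarrow> 2) set). if e = undefined \<and> x = a then 1 / (real ?N)\<^sup>2 else 0)"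
    unfolding sum_UNIV_prod by (simp only: entry)
  also have "\<dots> = (\<Sum>e\<in>(UNIV :: 'e set). \<Sum>x\<in>(UNIV :: ('n \<Rightarrow> 2) set). if e = undefined then real ?N * (1 / (real ?N)\<^sup>2) else 0)"
  proof (intro sum.cong refl)
    fix e :: 'e and x :: "'n \<Rightarrow> 2"
    have "(\<Sum>a\<in>UNIV. \<Sum>b\<in>(UNIV :: ('n \<Rightarrow> 2) set). if e = undefined \<and> x = a then 1 / (real ?N)\<^sup>2 else 0)
       = (\<Sum>a\<in>UNIV. if a = x then if e = undefined then real ?N * (1 / (real ?N)\<^sup>2) else 0 else 0)"
      by (intro sum.cong refl) auto
    then show "(\<Sum>a\<in>UNIV. \<Sum>b\<in>(UNIV :: ('n \<Rightarrow> 2) set). if e = undefined \<and> x = a then 1 / (real ?N)\<^sup>2 else 0)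
       = (if e = undefined then real ?N * (1 / (real ?N)\<^sup>2) else 0)" by simp
  qed
  also have "\<dots> = (\<Sum>e\<in>(UNIV :: 'e set). if e = undefined then 1 else 0)"
    by (intro sum.cong refl) (simp add: power2_eq_square)
  finally show "(\<Sum>p\<in>UNIV. (cmod (?\<phi> $ p))\<^sup>2) = 1" by simp
qed

lemma probe_orthogonal:
  fixes i :: "'n::finite"
  defines "\<phi> \<equiv> probe i :: complex ^ ('e::finite \<times> (('n \<Rightarrow> 2) \<times> ('n \<Rightarrow> 2)) \<times> ('n \<Rightarrow> 2))"
  assumes lin: "op_linear L"
  shows "tensor_map id (relabel twist) (outer \<phi>) ** tensor_map id (tensor_map L id) (outer \<phi>) = 0"
    (is "?P ** ?Q = 0")
proof -
  \<comment> \<open>The amplitude with Bob's label removed, since the probe is constant in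
    \<open>b\<close>.\<close>
  define amp where "amp e x a = (if e = undefined \<and> x = a then parity i x / of_nat CARD('n \<Rightarrow> 2) else 0)" for e :: 'e and x a :: "'n \<Rightarrow> 2"
  \<comment> \<open>The sign \<open>parity i b\<close> is kicked back to Bob's register, whereas \<open>?Q\<close> leaves that register uniform.\<close>
  have probe_twist: "\<phi> $ (e, twist ((x, a), b)) = amp e x a * parity i b" for e x a b
    by (auto simp: \<phi>_def probe_def twist_def amp_def parity_add fun_eq_iff)
  have P: "?P $ u $ (e, ((x, a), b)) = \<phi> $ (fst u, twist (snd u)) * cnj (amp e x a) * parity i b" for u e x a b
    unfolding relabel_id(2)[symmetric] tensor_map_relabel
    by (simp add: outer_def probe_twist map_prod_def split_beta)
  have Q: "?Q $ (e, (z, b)) $ w = ?Q $ (e, (z, b')) $ w" for e z b b' w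
  proof -
    obtain f y c where w: "w = (f, (y, c))" by (metis surj_pair)
    \<comment> \<open>The input blocks selected by \<open>b\<close> and \<open>b'\<close> coincide,
      hence so do their images under \<open>L\<close>.\<close>
    have "(\<chi> r s. outer \<phi> $ (e, (r, b)) $ (f, (s, c))) = (\<chi> r s. outer \<phi> $ (e, (r, b')) $ (f, (s, c)))"
      by (simp add: vec_eq_iff outer_def \<phi>_def probe_def split_beta)
    then show ?thesis by (simp only: w tensor_map_local[OF lin])
  qed
  \<comment> \<open>In the matrix product, summing over Bob's middle label leaves a constant times
    the sum of the character. The all-zero string \<open>?b\<close> is the reference label for the
    constant factor of \<open>?Q\<close>.\<close>
  have "(\<Sum>b\<in>UNIV. ?P $ u $ (e, ((x, a), b)) * ?Q $ (e, ((x, a), b)) $ w) = 0" for u e x a w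
  proof -
    let ?b = "\<lambda>_. 0"
    have "(\<Sum>b\<in>UNIV. ?P $ u $ (e, ((x, a), b)) * ?Q $ (e, ((x, a), b)) $ w)
      = (\<Sum>b\<in>UNIV. \<phi> $ (fst u, twist (snd u)) * cnj (amp e x a) * ?Q $ (e, ((x, a), ?b)) $ w * parity i b)"
    proof (rule sum.cong[OF refl])
      fix b
      show "?P $ u $ (e, ((x, a), b)) * ?Q $ (e, ((x, a), b)) $ w
        = \<phi> $ (fst u, twist (snd u)) * cnj (amp e x a) * ?Q $ (e, ((x, a), ?b)) $ w * parity i b"
        unfolding P Q[of e "(x, a)" b w ?b] by (simp only: ac_simps)
    qed
    also have "\<dots> = 0" by (simp add: sum_parity flip: sum_distrib_left)
    finally show ?thesis .
  qed
  then show ?thesis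
    by (simp add: vec_eq_iff matrix_matrix_mult_def sum_UNIV_prod)
qed

text \<open>Every input yields two density operators, at distance at most 2, and the probe makes
  them orthogonal. The value is the same for every \<open>L\<close>, so the infimum will be over a
  constant.\<close>

lemma diamond_norm_cnot:
  fixes L :: "(('n::finite \<Rightarrow> 2) \<times> ('n \<Rightarrow> 2)) oper \<Rightarrow> (('n \<Rightarrow> 2) \<times> ('n \<Rightarrow> 2)) oper"
  assumes L: "L \<in> channels"
  shows "diamond_norm (\<lambda>\<rho>. T_channel (bipartite_power cnot_channel) \<rho> - tensor_map L id \<rho>) = 2"
proof -
  let ?P = "tensor_map id (relabel twist)" and ?Q = "tensor_map id (tensor_map L id)"
  \<comment> \<open>Any coordinate serves; one exists because types are nonempty, which is the
    condition that \<open>n\<close> is at least 1.\<close>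
  let ?\<phi> = "probe (undefined :: 'n)"
  have P: "?P \<rho> \<in> density" if "\<rho> \<in> density" for \<rho>
    unfolding relabel_id(2)[symmetric] tensor_map_relabel
    using density_relabel[OF bij_betw_map_prod[OF bij_id bij_twist, unfolded UNIV_Times_UNIV] that] .
  note Q = density_local[OF L]
  have le: "trace_norm (?P \<rho> - ?Q \<rho>) \<le> 2" if "\<rho> \<in> density" for \<rho>
    by (intro trace_norm_density_diff_le P Q that)
  have eq: "trace_norm (?P (outer ?\<phi>) - ?Q (outer ?\<phi>)) = 2"
    using L by (intro trace_norm_density_diff_orthogonal P Q probe_density probe_orthogonal)
      (simp add: channels_def)
  show ?thesis
    unfolding diamond_norm_def T_channel_cnot tensor_map_diff_right
  proof (rule cSup_eq_maximum)
    show "2 \<in> (\<lambda>\<rho>. trace_norm (?P \<rho> - ?Q \<rho>)) ` density"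
      using eq[symmetric] probe_density by (rule image_eqI)
  qed (use le in blast)
qed

theorem theorem3p3:
  shows "causal_influence
    (bipartite_power cnot_channel ::
      (('n::finite \<Rightarrow> 2) \<times> ('n \<Rightarrow> 2)) oper \<Rightarrow> (('n \<Rightarrow> 2) \<times> ('n \<Rightarrow> 2)) oper) = 2"
proof -
  have "causal_influence (bipartite_power cnot_channel ::
      (('n::finite \<Rightarrow> 2) \<times> ('n \<Rightarrow> 2)) oper \<Rightarrow> (('n \<Rightarrow> 2) \<times> ('n \<Rightarrow> 2)) oper)
    = (INF L\<in>(channels :: ((('n \<Rightarrow> 2) \<times> ('n \<Rightarrow> 2)) oper \<Rightarrow> (('n \<Rightarrow> 2) \<times> ('n \<Rightarrow> 2)) oper) set). 2)"
    unfolding causal_influence_def by (intro arg_cong[where f = Inf] image_cong refl) (simp add: diamond_norm_cnot)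
  also have "\<dots> = 2" using id_channel by (intro cINF_const) blast
  finally show ?thesis .
qed

end
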